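(* Let $A=(a_{ij})$ be an $n\times n$ PS (permuted-shifted) monotone anti-Monge matrix and let $B=(b_{ij})$ be an $n\times n$ up-benevolent Toeplitz matrix. Then the identity permutation is an optimal solution of $QAP(A,B)$, i.e. for every permutation $\pi$ of $\{1,\ldots,n\}$, $$\sum_{i=1}^n\sum_{j=1}^n a_{ij}\,b_{ij}\;\le\;\sum_{i=1}^n\sum_{j=1}^n a_{\pi(i)\pi(j)}\,b_{ij}.$$
   Context: $QAP(A,B)$: for real $n\times n$ matrices $A=(a_{ij})$, $B=(b_{ij})$, minimize $Z_\pi(A,B)=\sum_{i,j=1}^n a_{\pi(i)\pi(j)}b_{ij}$ over all permutations $\pi$ of $\{1,\ldots,n\}$. Permuting a matrix $M=(m_{ij})$ according to a permutation $\pi$ yields the matrix $M^\pi$ with entries $m_{\pi(i)\pi(j)}$. A Toeplitz matrix with generating function $f\colon\{-n+1,\ldots,n-1\}\to\mathbb{R}$ is the $n\times n$ matrix with $b_{ij}=f(i-j)$. An up-benevolent Toeplitz matrix is a symmetric $n\times n$ Toeplitz matrix whose generating function $f$ satisfies $f(0)=0$, $f(1)\le f(2)\le\cdots\le f(\lceil\frac{n-1}{2}\rceil)$, and $f(i)\le f(n-i)$ for all $1\le i\le\lceil\frac{n-1}{2}\rceil$. For $1\le p,q\le n$ let $R^{(p,q)}$ be the $n\times n$ $0$-$1$ matrix whose $(i,j)$ entry is $1$ if and only if $n-p+1\le i\le n$ and $n-q+1\le j\le n$. Put $\bar R^{(p,q)}=R^{(p,q)}+R^{(q,p)}$ for $1\le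 p<q\le n$ and $\bar R^{(p,p)}=R^{(p,p)}$ for $1\le p\le n$. The Supnick permutation is $\pi^*=\langle 1,3,5,\ldots,6,4,2\rangle$, i.e. the sequence $\pi^*(1),\ldots,\pi^*(n)$ lists first the odd numbers in $\{1,\ldots,n\}$ increasingly and then the even numbers decreasingly. For $1\le p\le q\le n$ let $\bar R^{(p,q,\pi^* )}$ be the matrix obtained by permuting $\bar R^{(p,q)}$ according to $\pi^*$; its non-zero entries lie in rows and columns with indices between $\lceil\frac{n-q}{2}\rceil+1$ and $n-\lfloor\frac{n-q}{2}\rfloor$. For $1\le u\le n$ let $\sigma_u=\langle u,u+1,\ldots,n,1,\ldots,u-1\rangle$ (a cyclic shift; $\sigma_1$ is the identity), and let $C^{(p,q,u)}$ be the matrix obtained by permuting $\bar R^{(p,q,\pi^* )}$ according to $\sigma_u$. The shift $u$ is called admissible for $(p,q)$ if the block of non-zero entries does not wrap around the border of the matrix, i.e. if $1\le u\le\lceil\frac{n-q}{2}\rceil+1$ or $n-\lfloor\frac{n-q}{2}\rfloor+1\le u\le n$. A symmetric $n\times n$ matrix is a PS monotone anti-Monge matrix if it is a conic combination (linear combination with non-negative coefficients) of matrices $C^{(p,q,u)}$ with $1\le p\le q\le n$ and $u$ admissible for $(p,q)$. *)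

theory Defs
  imports Complex_Main "HOL-Combinatorics.Permutations"
begin

text \<open>
  An \<open>n \<times> n\<close> matrix is a function \<^typ>\<open>nat \<Rightarrow> nat \<Rightarrow> real\<close> of which only
  the entries with both indices in \<open>{1..n}\<close> matter.
\<close>

type_synonym matrix = "nat \<Rightarrow> nat \<Rightarrow> real"

definition symmetric_matrix :: "nat \<Rightarrow> matrix \<Rightarrow> bool" where
  "symmetric_matrix n M \<longleftrightarrow> (\<forall>i\<in>{1..n}. \<forall>j\<in>{1..n}. M i j = M j i)"

definition permute_matrix :: "matrix \<Rightarrow> (nat \<Rightarrow> nat) \<Rightarrow> matrix" where
  "permute_matrix M \<pi> = (\<lambda>i j. M (\<pi> i) (\<pi> j))"

definition qap_cost :: "nat \<Rightarrow> matrix \<Rightarrow> matrix \<Rightarrow> (nat \<Rightarrow> nat) \<Rightarrow> real" where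
  "qap_cost n A B \<pi> = (\<Sum>i=1..n. \<Sum>j=1..n. A (\<pi> i) (\<pi> j) * B i j)"

definition qap_optimal :: "nat \<Rightarrow> matrix \<Rightarrow> matrix \<Rightarrow> (nat \<Rightarrow> nat) \<Rightarrow> bool" where
  "qap_optimal n A B \<pi> \<longleftrightarrow> is_arg_min (qap_cost n A B) (\<lambda>\<sigma>. \<sigma> permutes {1..n}) \<pi>"

text \<open>
  The generating function is a function on all integers; only its values on
  \<open>{-n+1..n-1}\<close> are used.
\<close>

definition toeplitz_matrix :: "nat \<Rightarrow> (int \<Rightarrow> real) \<Rightarrow> matrix \<Rightarrow> bool" where
  "toeplitz_matrix n f B \<longleftrightarrow> (\<forall>i\<in>{1..n}. \<forall>j\<in>{1..n}. B i j = f (int i - int j))"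

definition up_benevolent :: "nat \<Rightarrow> (int \<Rightarrow> real) \<Rightarrow> bool" where
  "up_benevolent n f \<longleftrightarrow>
     f 0 = 0 \<and>
     (\<forall>i. 1 \<le> i \<and> i + 1 \<le> \<lceil>(real n - 1) / 2\<rceil> \<longrightarrow> f i \<le> f (i + 1)) \<and>
     (\<forall>i. 1 \<le> i \<and> i \<le> \<lceil>(real n - 1) / 2\<rceil> \<longrightarrow> f i \<le> f (int n - i))"

definition up_benevolent_toeplitz_matrix :: "nat \<Rightarrow> matrix \<Rightarrow> bool" where
  "up_benevolent_toeplitz_matrix n B \<longleftrightarrow>
     symmetric_matrix n B \<and> (\<exists>f. toeplitz_matrix n f B \<and> up_benevolent n f)"

definition R_matrix :: "nat \<Rightarrow> nat \<Rightarrow> nat \<Rightarrow> matrix" where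
  "R_matrix n p q = (\<lambda>i j.
     if n - p + 1 \<le> i \<and> i \<le> n \<and> n - q + 1 \<le> j \<and> j \<le> n then 1 else 0)"

definition Rbar_matrix :: "nat \<Rightarrow> nat \<Rightarrow> nat \<Rightarrow> matrix" where
  "Rbar_matrix n p q = (\<lambda>i j.
     if p = q then R_matrix n p p i j else R_matrix n p q i j + R_matrix n q p i j)"

text \<open>
  A permutation written as a sequence \<open>\<langle>\<pi>(1), \<dots>, \<pi>(n)\<rangle>\<close>, read as a function.
  Lists are indexed from 0, hence the offset; values outside \<open>{1..n}\<close> are not used.
\<close>

definition of_sequence :: "nat list \<Rightarrow> nat \<Rightarrow> nat" where
  "of_sequence xs i = xs ! (i - 1)"

definition supnick_perm :: "nat \<Rightarrow> nat \<Rightarrow> nat" where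
  "supnick_perm n =
     of_sequence (filter odd [1..<n + 1] @ rev (filter even [1..<n + 1]))"

definition shift_perm :: "nat \<Rightarrow> nat \<Rightarrow> nat \<Rightarrow> nat" where
  "shift_perm n u = of_sequence ([u..<n + 1] @ [1..<u])"

definition C_matrix :: "nat \<Rightarrow> nat \<Rightarrow> nat \<Rightarrow> nat \<Rightarrow> matrix" where
  "C_matrix n p q u =
     permute_matrix (permute_matrix (Rbar_matrix n p q) (supnick_perm n)) (shift_perm n u)"

definition admissible_shift :: "nat \<Rightarrow> nat \<Rightarrow> nat \<Rightarrow> bool" where
  "admissible_shift n q u \<longleftrightarrow>
     1 \<le> u \<and> int u \<le> \<lceil>(real n - real q) / 2\<rceil> + 1 \<or>
     int n - \<lfloor>(real n - real q) / 2\<rfloor> + 1 \<le> int u \<and> u \<le> n"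

definition admissible_triples :: "nat \<Rightarrow> (nat \<times> nat \<times> nat) set" where
  "admissible_triples n =
     {(p, q, u). 1 \<le> p \<and> p \<le> q \<and> q \<le> n \<and> 1 \<le> u \<and> u \<le> n \<and> admissible_shift n q u}"

definition PS_monotone_anti_Monge :: "nat \<Rightarrow> matrix \<Rightarrow> bool" where
  "PS_monotone_anti_Monge n A \<longleftrightarrow>
     symmetric_matrix n A \<and>
     (\<exists>c. (\<forall>t\<in>admissible_triples n. c t \<ge> 0) \<and>
          (\<forall>i\<in>{1..n}. \<forall>j\<in>{1..n}.
             A i j = (\<Sum>(p, q, u)\<in>admissible_triples n. c (p, q, u) * C_matrix n p q u i j)))"

text \<open>The set of generators is finite, so that the sum above is a genuine one.\<close>

lemma finite_admissible_triples: "finite (admissible_triples n)"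
  by (rule finite_subset[of _ "{1..n} \<times> {1..n} \<times> {1..n}"]) (auto simp: admissible_triples_def)

end

theory Submission
  imports Defs
begin

text \<open>
  The cost is linear in the first matrix, so it is enough to compare the identity with a
  permutation \<open>\<pi>\<close> for one generator of the cone. A generator is the (symmetrised) indicator of a
  product \<open>P \<times> Q\<close> with \<open>P \<subseteq> Q\<close>, where \<open>P\<close> and \<open>Q\<close> are intervals of lengths \<open>p\<close> and \<open>q\<close> with almost
  the same midpoint; permuting it replaces them by arbitrary sets \<open>P \<subseteq> Q\<close> of these sizes. The claim
  is therefore a rearrangement inequality: among all such pairs of sets, the sum of
  \<open>\<phi> \<bar>i - j\<bar>\<close> over \<open>i \<in> P\<close>, \<open>j \<in> Q\<close> is least for centred intervals.

  The up-benevolent weights \<open>\<phi>\<close> form a cone as well. Off the diagonal, \<open>\<phi>\<close> is a constant plus a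
  non-negative combination of the indicators of \<open>k < d < n - k\<close> and of the indicators of a single
  distance \<open>d > n/2\<close> (\<open>weight_decomposition\<close>). The constant contributes the same amount to every
  pair \<open>P \<subseteq> Q\<close>, since the diagonal is met exactly \<open>p\<close> times. Two families of counts remain, and
  centred intervals minimise all of them simultaneously.

  For a distance \<open>d > n/2\<close>, the pairs of positions at distance \<open>d\<close> join the first \<open>n - d\<close>
  positions to the last \<open>n - d\<close> ones, and counting the positions that \<open>P\<close> and \<open>Q\<close> miss shows that
  at least \<open>p + q - 2 d\<close> ordered pairs survive (\<open>pair_count_long_ge\<close>). Centred intervals have
  at most \<open>max 0 (p + q - 2 d)\<close> pairs at each distance \<open>d \<ge> 1\<close> (\<open>pair_count_centred_le\<close>).

  The condition \<open>k < d < n - k\<close> says that the distance is more than \<open>k\<close> on the circle of \<open>n\<close>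
  points. Bounding the number of such pairs from below is a Riesz rearrangement inequality on the
  cyclic group, the third set being the arc \<open>{-k..k}\<close>. Put \<open>K = 2 k + 1\<close> and let \<open>r x\<close> be the
  number of points of \<open>P\<close> in the arc of length \<open>K\<close> around \<open>x\<close>. For a threshold \<open>t\<close>, the sum of \<open>r\<close>
  over \<open>Q\<close> is at most \<open>t q\<close> plus the total excess of \<open>r\<close> over \<open>t\<close>, and this excess is determined
  by the total shortage of \<open>r\<close> below \<open>t\<close>. As a function of the window length the shortage is
  convex, and it is known exactly at the lengths \<open>t\<close> and \<open>n - p + t\<close>; the chord between these two
  points bounds it in between (\<open>shortage_bound\<close>). For a suitable \<open>t\<close> the resulting bound is the sum
  of the arithmetic progression \<open>p + q - 2 d\<close>, which dominates the count of the centred intervals;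
  if \<open>Q\<close> is so much longer than \<open>P\<close> that the centred count falls below this sum, \<open>t = 0\<close> gives the
  exact value (\<open>centred_minimises_far\<close>).
\<close>

section \<open>Windows of a periodic sequence\<close>

lemma sum_over_shifted_period:
  fixes h :: "nat \<Rightarrow> nat"
  assumes "\<And>x. h (x + n) = h x"
  shows "(\<Sum>x<n. h (x + s)) = (\<Sum>x<n. h x)"
proof (induction s)
  case (Suc s)
  have "h s + (\<Sum>x<n. h (Suc x + s)) = (\<Sum>x<n. h (x + s)) + h (n + s)"
    using sum.lessThan_Suc_shift[of "\<lambda>x. h (x + s)" n] by simp
  moreover have "h (n + s) = h s"
    using assms[of s] by (simp add: add.commute)
  ultimately show ?case using Suc by simp
qed simp

text \<open>
  A subset of the circle is represented by the \<open>n\<close>-periodic extension \<open>a\<close> of its indicator to the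
  natural numbers, so that a cyclic arc starting at \<open>x\<close> becomes an ordinary window of length \<open>l\<close>.
\<close>

definition window :: "(nat \<Rightarrow> nat) \<Rightarrow> nat \<Rightarrow> nat \<Rightarrow> nat" where
  "window a l x = (\<Sum>m<l. a (x + m))"

text \<open>
  Truncated subtraction is essential here: windows holding more than \<open>t\<close> points contribute nothing.
\<close>

definition shortage :: "(nat \<Rightarrow> nat) \<Rightarrow> nat \<Rightarrow> nat \<Rightarrow> nat \<Rightarrow> nat" where
  "shortage a n t l = (\<Sum>x<n. t - window a l x)"

lemma window_Suc: "window a (Suc l) x = window a l x + a (x + l)"
  by (simp add: window_def)

lemma window_le:
  assumes "\<And>x. a x \<le> 1"
  shows "window a l x \<le> l"
  using sum_mono[of "{..<l}" "\<lambda>m. a (x + m)" "\<lambda>_. 1"] assms by (simp add: window_def)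

lemma window_add: "window a (l + m) x = window a l x + window a m (x + l)"
  by (induction m) (simp_all add: window_Suc add.assoc, simp add: window_def)

lemma window_periodic:
  assumes "\<And>x. a (x + n) = a x"
  shows "window a l (x + n) = window a l x"
proof -
  have "a (x + n + m) = a (x + m)" for m
    using assms[of "x + m"] by (simp add: ac_simps)
  then show ?thesis by (simp add: window_def)
qed

lemma window_full_period:
  assumes "\<And>x. a (x + n) = a x"
  shows "window a n x = (\<Sum>y<n. a y)"
  using sum_over_shifted_period[of a n x] assms by (simp add: window_def add.commute)

lemma sum_window:
  assumes "\<And>x. a (x + n) = a x"
  shows "(\<Sum>x<n. window a l x) = l * (\<Sum>x<n. a x)"
proof -
  have "(\<Sum>x<n. window a l x) = (\<Sum>m<l. \<Sum>x<n. a (x + m))"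
    unfolding window_def by (rule sum.swap)
  also have "\<dots> = (\<Sum>m<l. \<Sum>x<n. a x)"
    using sum_over_shifted_period[of a n] assms by simp
  finally show ?thesis by simp
qed

text \<open>
  This is the negated discrete derivative of the shortage in the window length: lengthening a window
  by one lowers its shortage exactly if the window holds fewer than \<open>t\<close> points and the new position
  belongs to the set.
\<close>

definition shortage_drop :: "(nat \<Rightarrow> nat) \<Rightarrow> nat \<Rightarrow> nat \<Rightarrow> nat \<Rightarrow> nat" where
  "shortage_drop a n t l = (\<Sum>x<n. if window a l x < t then a (x + l) else 0)"

lemma shortage_eq_drop:
  assumes "\<And>x. a x \<le> 1"
  shows "shortage a n t l = shortage a n t (Suc l) + shortage_drop a n t l"
proof -
  have "t - window a l x =
      (t - window a (Suc l) x) + (if window a l x < t then a (x + l) else 0)" for x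
    using assms[of "x + l"] by (auto simp: window_Suc)
  then have "shortage a n t l =
      (\<Sum>x<n. (t - window a (Suc l) x) + (if window a l x < t then a (x + l) else 0))"
    unfolding shortage_def by simp
  then show ?thesis
    by (simp add: sum.distrib shortage_def shortage_drop_def)
qed

text \<open>
  Convexity of the shortage. The new position \<open>x + Suc l\<close> of the longer window at \<open>x\<close> is also the new
  position of the window of length \<open>l\<close> at \<open>x + 1\<close>, and the latter is contained in the former; so a
  drop at \<open>x\<close> for the length \<open>Suc l\<close> entails a drop at \<open>x + 1\<close> for the length \<open>l\<close>.
\<close>

lemma shortage_drop_Suc_le:
  assumes per: "\<And>x. a (x + n) = a x"
  shows "shortage_drop a n t (Suc l) \<le> shortage_drop a n t l"
proof -
  define h where "h x = (if window a l x < t then a (x + l) else 0)" for x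
  have "h (x + n) = h x" for x
  proof -
    have "a (x + n + l) = a (x + l)"
      using per[of "x + l"] by (simp add: ac_simps)
    then show ?thesis by (simp add: h_def window_periodic[of a n] per)
  qed
  then have shift: "(\<Sum>x<n. h (x + 1)) = (\<Sum>x<n. h x)"
    by (rule sum_over_shifted_period)
  have "window a l (x + 1) \<le> window a (Suc l) x" for x
    using window_add[of a 1 l x] by (simp add: window_def)
  then have "(if window a (Suc l) x < t then a (x + Suc l) else 0) \<le> h (x + 1)" for x
    using le_less_trans[of "window a l (x + 1)" "window a (Suc l) x" t] by (simp add: h_def)
  then have "shortage_drop a n t (Suc l) \<le> (\<Sum>x<n. h (x + 1))"
    unfolding shortage_drop_def by (intro sum_mono) auto
  then show ?thesis
    using shift by (simp add: shortage_drop_def h_def)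
qed

text \<open>
  The average of the first terms of a decreasing sequence is at least the average of more terms.
  Applied to the drops, this is the chord inequality for a convex function.
\<close>

lemma antimono_initial_average:
  fixes c :: "nat \<Rightarrow> nat"
  assumes "antimono c" and "m \<le> M"
  shows "m * (\<Sum>l<M. c l) \<le> M * (\<Sum>l<m. c l)"
proof -
  obtain d where M: "M = m + d"
    using assms(2) le_Suc_ex by blast
  have split: "(\<Sum>l<M. c l) = (\<Sum>l<m. c l) + (\<Sum>l<d. c (m + l))"
    unfolding M by (induction d) auto
  have "m * c m \<le> (\<Sum>l<m. c l)"
    using sum_mono[of "{..<m}" "\<lambda>_. c m" c] antimonoD[OF assms(1)] by simp
  moreover have "(\<Sum>l<d. c (m + l)) \<le> d * c m"
    using sum_mono[of "{..<d}" "\<lambda>l. c (m + l)" "\<lambda>_. c m"] antimonoD[OF assms(1)] by simp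
  ultimately have "m * (\<Sum>l<d. c (m + l)) \<le> m * (d * c m)"
    and "d * (m * c m) \<le> d * (\<Sum>l<m. c l)"
    by (auto intro: mult_le_mono2)
  then have "m * (\<Sum>l<d. c (m + l)) \<le> d * (\<Sum>l<m. c l)"
    by (simp only: mult.left_commute[of m d])
  then show ?thesis
    unfolding split by (simp add: M algebra_simps)
qed

text \<open>
  Every window of length \<open>t\<close> holds at most \<open>t\<close> points, so the shortage at length \<open>t\<close> is exactly
  \<open>t (n - p)\<close>. A window of length \<open>n - p + t\<close> misses only \<open>p - t\<close> positions of the circle and hence
  holds at least \<open>t\<close> of the \<open>p\<close> points, so the shortage there is \<open>0\<close>. By convexity it lies below the
  chord in between.
\<close>

lemma shortage_bound:
  assumes le1: "\<And>x. a x \<le> 1" and per: "\<And>x. a (x + n) = a x"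
    and p: "p = (\<Sum>x<n. a x)" and "t \<le> p" and "m \<le> n - p"
  shows "shortage a n t (t + m) \<le> t * (n - p - m)"
proof -
  define M where "M = n - p"
  define c where "c l = shortage_drop a n t (t + l)" for l
  have "p \<le> n"
    using sum_mono[of "{..<n}" a "\<lambda>_. 1"] le1 p by simp
  have "antimono c"
    using shortage_drop_Suc_le[of a n t] per
    by (intro decseq_SucI) (simp add: c_def)
  have drops: "shortage a n t t = shortage a n t (t + l) + (\<Sum>i<l. c i)" for l
  proof (induction l)
    case (Suc l)
    have "shortage a n t (t + l) = shortage a n t (t + Suc l) + c l"
      unfolding c_def add_Suc_right by (rule shortage_eq_drop) (rule le1)
    then show ?case using Suc by simp
  qed simp
  have "shortage a n t t + t * p = (\<Sum>x<n. (t - window a t x) + window a t x)"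
    using sum_window[of a n t] per by (simp add: shortage_def p sum.distrib)
  also have "\<dots> = t * n"
    using window_le[of a t] le1 by simp
  finally have start: "shortage a n t t = t * M"
    using \<open>p \<le> n\<close> by (simp add: M_def diff_mult_distrib2)
  have "t \<le> window a (t + M) x" for x
  proof -
    have "n = (t + M) + (p - t)"
      using \<open>p \<le> n\<close> \<open>t \<le> p\<close> by (simp add: M_def)
    then have "window a n x = window a (t + M) x + window a (p - t) (x + (t + M))"
      by (metis window_add)
    moreover have "window a n x = p"
      unfolding p by (rule window_full_period) (rule per)
    ultimately have "p = window a (t + M) x + window a (p - t) (x + (t + M))"
      by simp
    then show ?thesis
      using window_le[of a "p - t" "x + (t + M)"] le1 \<open>t \<le> p\<close> by simp
  qed
  then have "shortage a n t (t + M) = 0"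
    by (simp add: shortage_def)
  then have total: "(\<Sum>i<M. c i) = t * M"
    using drops[of M] start by simp
  have "m \<le> M" using assms by (simp add: M_def)
  then have "m * (t * M) \<le> M * (\<Sum>i<m. c i)"
    using antimono_initial_average[OF \<open>antimono c\<close>, of m M] total by simp
  then have "M * (m * t) \<le> M * (\<Sum>i<m. c i)" by (simp add: ac_simps)
  then have "m * t \<le> (\<Sum>i<m. c i)"
    using \<open>m \<le> M\<close> by (cases "M = 0") auto
  then show ?thesis
    unfolding M_def[symmetric] diff_mult_distrib2
    using drops[of m] start by (simp add: mult.commute[of m t])
qed

text \<open>
  With \<open>r\<close> the window count, each \<open>x\<close> satisfies \<open>b x * r x \<le> t * b x + (r x - t)\<close> in truncated
  subtraction, and \<open>(r x - t) + t = r x + (t - r x)\<close>. Summing turns the correlation of \<open>b\<close> with \<open>r\<close>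
  into a shortage. The free threshold \<open>t\<close> will later be chosen so that the bound is sharp.
\<close>

lemma correlation_bound:
  assumes "\<And>x. a x \<le> 1" "\<And>x. a (x + n) = a x" "p = (\<Sum>x<n. a x)"
    and "\<And>x. b x \<le> 1" "q = (\<Sum>x<n. b x)"
    and "t \<le> p" "t \<le> K" "K \<le> n - p + t"
  shows "(\<Sum>x<n. b x * window a K x) + t * n \<le> t * q + p * K + t * (n - p + t - K)"
proof -
  have pt: "b x * window a K x + t \<le> t * b x + window a K x + (t - window a K x)" for x
  proof -
    have "b x = 0 \<or> b x = 1" using assms(4)[of x] by linarith
    then show ?thesis by auto
  qed
  have "(\<Sum>x<n. b x * window a K x) + t * n = (\<Sum>x<n. b x * window a K x + t)"
    by (simp add: sum.distrib)
  also have "\<dots> \<le> (\<Sum>x<n. t * b x + window a K x + (t - window a K x))"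
    by (intro sum_mono pt)
  also have "\<dots> = t * q + p * K + shortage a n t K"
    using sum_window[of a n K] assms(2)
    by (simp add: sum.distrib shortage_def assms(3,5) flip: sum_distrib_left)
  also have "shortage a n t K \<le> t * (n - p - (K - t))"
    using shortage_bound[of a n p t "K - t"] assms by simp
  also have "n - p - (K - t) = n - p + t - K" using assms by simp
  finally show ?thesis by simp
qed

section \<open>Pairs of positions at prescribed distances\<close>

text \<open>
  One of the two truncated differences is always \<open>0\<close>, which makes this the distance on the naturals.
\<close>

definition gap :: "nat \<Rightarrow> nat \<Rightarrow> nat" where
  "gap i j = (i - j) + (j - i)"

definition pair_count :: "nat set \<Rightarrow> nat set \<Rightarrow> nat set \<Rightarrow> nat" where
  "pair_count D P Q = (\<Sum>i\<in>P. \<Sum>j\<in>Q. of_bool (gap i j \<in> D))"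

text \<open>
  Up to the same constant, \<open>2 * a + p\<close> and \<open>2 * c + q\<close> are twice the midpoints of \<open>{a..<a + p}\<close> and
  \<open>{c..<c + q}\<close>. They are allowed to differ by one because \<open>q - p\<close> may be odd; for \<open>p \<le> q\<close> the first
  interval is then contained in the second.
\<close>

definition centred :: "nat \<Rightarrow> nat \<Rightarrow> nat \<Rightarrow> nat \<Rightarrow> bool" where
  "centred a p c q \<longleftrightarrow> 2 * a + p \<le> 2 * c + q + 1 \<and> 2 * c + q \<le> 2 * a + p + 1"

lemma pair_count_complement:
  assumes "finite P" "finite Q"
  shows "pair_count D P Q + pair_count (- D) P Q = card P * card Q"
proof -
  have "pair_count D P Q + pair_count (- D) P Q =
      (\<Sum>i\<in>P. \<Sum>j\<in>Q. of_bool (gap i j \<in> D) + of_bool (gap i j \<in> - D))"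
    by (simp add: pair_count_def sum.distrib)
  also have "\<dots> = (\<Sum>i\<in>P. \<Sum>j\<in>Q. 1)"
    by (intro sum.cong) auto
  finally show ?thesis by simp
qed

lemma pair_count_by_distance:
  assumes "finite D"
  shows "pair_count D P Q = (\<Sum>d\<in>D. pair_count {d} P Q)"
proof -
  have "of_bool (x \<in> D) = (\<Sum>d\<in>D. of_bool (x = d) :: nat)" for x
    using assms by (simp add: of_bool_def)
  then have "pair_count D P Q = (\<Sum>i\<in>P. \<Sum>j\<in>Q. \<Sum>d\<in>D. of_bool (gap i j = d))"
    by (simp add: pair_count_def)
  also have "\<dots> = (\<Sum>i\<in>P. \<Sum>d\<in>D. \<Sum>j\<in>Q. of_bool (gap i j = d))"
    by (intro sum.cong refl sum.swap)
  also have "\<dots> = (\<Sum>d\<in>D. \<Sum>i\<in>P. \<Sum>j\<in>Q. of_bool (gap i j = d))"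
    by (rule sum.swap)
  finally show ?thesis by (simp add: pair_count_def)
qed

text \<open>
  For \<open>d \<ge> 1\<close> a position has at most two partners at distance \<open>d\<close>, one on each side.
\<close>

lemma pair_count_single:
  assumes "finite P" "finite Q" "1 \<le> d"
  shows "pair_count {d} P Q =
    card {i \<in> P. i + d \<in> Q} + card {i \<in> P. d \<le> i \<and> i - d \<in> Q}"
proof -
  have "(\<Sum>j\<in>Q. of_bool (gap i j \<in> {d})) =
      (of_bool (i + d \<in> Q) + of_bool (d \<le> i \<and> i - d \<in> Q) :: nat)" for i
  proof -
    have "(\<Sum>j\<in>Q. of_bool (gap i j \<in> {d}) :: nat) =
        (\<Sum>j\<in>Q. of_bool (j = i + d) + of_bool (d \<le> i \<and> j = i - d))"
      using assms(3) by (intro sum.cong) (auto simp: gap_def of_bool_def)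
    also have "\<dots> = (\<Sum>j\<in>Q. of_bool (j = i + d)) + (\<Sum>j\<in>Q. of_bool (d \<le> i \<and> j = i - d))"
      by (rule sum.distrib)
    also have "\<dots> = of_bool (i + d \<in> Q) + of_bool (d \<le> i \<and> i - d \<in> Q)"
      using assms(2) by (auto simp: of_bool_def)
    finally show ?thesis .
  qed
  then have "pair_count {d} P Q =
      (\<Sum>i\<in>P. of_bool (i + d \<in> Q)) + (\<Sum>i\<in>P. of_bool (d \<le> i \<and> i - d \<in> Q))"
    by (simp add: pair_count_def sum.distrib)
  then show ?thesis
    using assms(1) by (simp add: sum_of_bool_eq Int_def)
qed

section \<open>Lower bounds for arbitrary sets\<close>

lemma card_Int_ge:
  assumes "A \<subseteq> S" "B \<subseteq> S" "finite S"
  shows "card A + card B \<le> card (A \<inter> B) + card S"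
proof -
  have "card A + card B = card (A \<union> B) + card (A \<inter> B)"
    using assms by (intro card_Un_Int) (auto intro: finite_subset)
  moreover have "card (A \<union> B) \<le> card S"
    using assms by (intro card_mono) auto
  ultimately show ?thesis by simp
qed

lemma card_split_ends:
  assumes "P \<subseteq> {..<n}" "d \<le> n" "n \<le> 2 * d"
  shows "card P \<le> card (P \<inter> {..<n - d}) + card (P \<inter> {d..<n}) + (2 * d - n)"
proof -
  have "P \<subseteq> (P \<inter> {..<n - d}) \<union> (P \<inter> {d..<n}) \<union> {n - d..<d}"
    using assms by auto
  then have "card P \<le> card ((P \<inter> {..<n - d}) \<union> (P \<inter> {d..<n}) \<union> {n - d..<d})"
    by (intro card_mono) auto
  also have "\<dots> \<le> card (P \<inter> {..<n - d}) + card (P \<inter> {d..<n}) + card {n - d..<d}"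
    by (meson add_mono card_Un_le le_refl order_trans)
  finally show ?thesis using assms by simp
qed

text \<open>
  For \<open>n \<le> 2 d\<close> translation by \<open>d\<close> matches the first \<open>n - d\<close> positions with the last \<open>n - d\<close> ones. If
  \<open>P\<close> meets the first block and \<open>Q\<close> the last one in many points, then many matched pairs lie in
  \<open>P \<times> Q\<close>, and likewise with the blocks exchanged. Each set has at most \<open>2 d - n\<close> points outside
  the blocks.
\<close>

lemma pair_count_long_ge:
  assumes P: "P \<subseteq> {..<n}" and Q: "Q \<subseteq> {..<n}" and "1 \<le> d" "d \<le> n" "n \<le> 2 * d"
  shows "card P + card Q \<le> pair_count {d} P Q + 2 * d"
proof -
  have fin: "finite P" "finite Q"
    using P Q by (auto intro: finite_subset)
  have "card (P \<inter> {..<n - d}) + card (Q \<inter> {d..<n}) \<le> card {i \<in> P. i + d \<in> Q} + (n - d)"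
  proof -
    have img: "card ((\<lambda>i. i - d) ` (Q \<inter> {d..<n})) = card (Q \<inter> {d..<n})"
      by (intro card_image) (auto simp: inj_on_def)
    have "(\<lambda>i. i - d) ` (Q \<inter> {d..<n}) \<subseteq> {..<n - d}"
      by auto
    then have "card (P \<inter> {..<n - d}) + card ((\<lambda>i. i - d) ` (Q \<inter> {d..<n})) \<le>
        card (P \<inter> {..<n - d} \<inter> (\<lambda>i. i - d) ` (Q \<inter> {d..<n})) + card {..<n - d}"
      by (rule card_Int_ge[OF Int_lower2]) simp
    moreover have "card (P \<inter> {..<n - d} \<inter> (\<lambda>i. i - d) ` (Q \<inter> {d..<n})) \<le>
        card {i \<in> P. i + d \<in> Q}"
      using fin by (intro card_mono) auto
    ultimately show ?thesis unfolding img by simp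
  qed
  moreover have "card (P \<inter> {d..<n}) + card (Q \<inter> {..<n - d}) \<le>
      card {i \<in> P. d \<le> i \<and> i - d \<in> Q} + (n - d)"
  proof -
    have img: "card ((\<lambda>i. i + d) ` (Q \<inter> {..<n - d})) = card (Q \<inter> {..<n - d})"
      by (intro card_image) (auto simp: inj_on_def)
    have "(\<lambda>i. i + d) ` (Q \<inter> {..<n - d}) \<subseteq> {d..<n}"
      by auto
    then have "card (P \<inter> {d..<n}) + card ((\<lambda>i. i + d) ` (Q \<inter> {..<n - d})) \<le>
        card (P \<inter> {d..<n} \<inter> (\<lambda>i. i + d) ` (Q \<inter> {..<n - d})) + card {d..<n}"
      by (rule card_Int_ge[OF Int_lower2]) simp
    moreover have "card (P \<inter> {d..<n} \<inter> (\<lambda>i. i + d) ` (Q \<inter> {..<n - d})) \<le>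
        card {i \<in> P. d \<le> i \<and> i - d \<in> Q}"
      using fin by (intro card_mono) auto
    ultimately show ?thesis unfolding img by simp
  qed
  ultimately show ?thesis
    unfolding pair_count_single[OF fin assms(3)]
    using card_split_ends[OF P assms(4,5)] card_split_ends[OF Q assms(4,5)] assms(3-5)
    by linarith
qed

text \<open>
  The points of \<open>P\<close> at circular distance at most \<open>k\<close> from \<open>j\<close> lie in the window of length \<open>2 k + 1\<close>
  that starts at \<open>j - k\<close>; the start is written \<open>j + (n - k)\<close> to stay within the naturals.
\<close>

lemma circularly_close_le_window:
  assumes "P \<subseteq> {..<n}" "j < n" "k < n"
  shows "(\<Sum>i\<in>P. of_bool (gap i j \<in> - {k<..<n - k})) \<le>
    window (\<lambda>z. of_bool (z mod n \<in> P)) (2 * k + 1) (j + (n - k))"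
proof -
  let ?g = "\<lambda>m. (j + (n - k) + m) mod n"
  have fin: "finite P" using assms(1) by (auto intro: finite_subset)
  have "{i \<in> P. gap i j \<in> - {k<..<n - k}} \<subseteq> ?g ` {m. m < 2 * k + 1 \<and> ?g m \<in> P}"
  proof
    fix i assume i: "i \<in> {i \<in> P. gap i j \<in> - {k<..<n - k}}"
    then have "i < n" using assms(1) by auto
    consider (near) "gap i j \<le> k" | (right) "j + (n - k) \<le> i" | (left) "i + (n - k) \<le> j"
      using i by (auto simp: gap_def split: if_splits) linarith
    \<comment> \<open>\<open>m\<close> is the offset of \<open>i\<close> in the window, and \<open>e\<close> counts the turns around the circle.\<close>
    then obtain m e where m: "m < 2 * k + 1" "j + (n - k) + m = i + e * n"
    proof cases
      case near
      then show ?thesis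
        using that[of "i + k - j" 1] assms(3) by (simp add: gap_def)
    next
      case right
      then show ?thesis
        using that[of "i + k - j - n" 0] assms(3) \<open>i < n\<close> by simp
    next
      case left
      then show ?thesis
        using that[of "i + n + k - j" 2] assms(2,3) by simp
    qed
    then have "?g m = i" using \<open>i < n\<close> by simp
    then show "i \<in> ?g ` {m. m < 2 * k + 1 \<and> ?g m \<in> P}"
      using m(1) i by (intro image_eqI[of _ _ m]) auto
  qed
  then have "card {i \<in> P. gap i j \<in> - {k<..<n - k}} \<le> card {m. m < 2 * k + 1 \<and> ?g m \<in> P}"
    by (rule surj_card_le[rotated]) simp
  moreover have "(\<Sum>i\<in>P. of_bool (gap i j \<in> - {k<..<n - k})) = card {i \<in> P. gap i j \<in> - {k<..<n - k}}"
    using fin by (simp add: sum_of_bool_eq Int_def)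
  moreover have "window (\<lambda>z. of_bool (z mod n \<in> P)) (2 * k + 1) (j + (n - k)) =
      card {m. m < 2 * k + 1 \<and> ?g m \<in> P}"
    unfolding window_def by (simp only: sum_of_bool_eq finite_lessThan of_nat_id)
      (intro arg_cong[where f = card], auto)
  ultimately show ?thesis by simp
qed

lemma sum_of_bool_mod:
  fixes n :: nat
  assumes "P \<subseteq> {..<n}"
  shows "(\<Sum>x<n. of_bool (x mod n \<in> P)) = card P"
proof -
  have "(\<Sum>x<n. of_bool (x mod n \<in> P)) = (\<Sum>x<n. of_bool (x \<in> P) :: nat)"
    by (intro sum.cong) auto
  also have "\<dots> = card ({..<n} \<inter> P)" by simp
  finally show ?thesis using assms by (simp add: Int_absorb1)
qed

text \<open>
  The lower bound obtained from \<open>correlation_bound\<close> by passing to the complementary set of pairs: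
  \<open>p q - (p K + t q + t (n - p + t - K) - t n) = (p - t) (q - K + t)\<close> for \<open>K = 2 k + 1\<close>.
\<close>

lemma pair_count_far_ge:
  assumes P: "P \<subseteq> {..<n}" and Q: "Q \<subseteq> {..<n}" and k: "2 * k + 1 \<le> n"
    and t: "t \<le> card P" "t \<le> 2 * k + 1" "2 * k + 1 \<le> n - card P + t"
  shows "(int (card P) - int t) * (int (card Q) - (2 * int k + 1) + int t) \<le>
    int (pair_count {k<..<n - k} P Q)"
proof -
  define a b :: "nat \<Rightarrow> nat"
    where "a z = of_bool (z mod n \<in> P)" and "b z = of_bool ((z + k) mod n \<in> Q)" for z
  define p q where "p = card P" and "q = card Q"
  have fin: "finite P" "finite Q" using P Q by (auto intro: finite_subset)
  have per: "a (x + n) = a x" "b (x + n) = b x" for x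
    by (simp_all add: a_def b_def mod_simps add.assoc add.commute[of n k])
      (metis add.assoc mod_add_self2)
  have le1: "a x \<le> 1" "b x \<le> 1" for x
    by (simp_all add: a_def b_def)
  have "(\<Sum>x<n. b x) = (\<Sum>x<n. of_bool (x mod n \<in> Q))"
    unfolding b_def by (rule sum_over_shifted_period) simp
  then have suma: "p = (\<Sum>x<n. a x)" and sumb: "q = (\<Sum>x<n. b x)"
    using sum_of_bool_mod[OF P] sum_of_bool_mod[OF Q] by (simp_all add: a_def p_def q_def)
  have "pair_count (- {k<..<n - k}) P Q = (\<Sum>j\<in>Q. \<Sum>i\<in>P. of_bool (gap i j \<in> - {k<..<n - k}))"
    unfolding pair_count_def by (rule sum.swap)
  also have "\<dots> \<le> (\<Sum>j\<in>Q. window a (2 * k + 1) (j + (n - k)))"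
    unfolding a_def using Q k by (intro sum_mono circularly_close_le_window P) auto
  also have "\<dots> = (\<Sum>j<n. b (j + (n - k)) * window a (2 * k + 1) (j + (n - k)))"
    using Q k by (intro sum.mono_neutral_cong_left) (auto simp: b_def)
  also have "\<dots> = (\<Sum>j<n. b j * window a (2 * k + 1) j)"
    by (rule sum_over_shifted_period[where h = "\<lambda>j. b j * window a (2 * k + 1) j"])
      (simp add: per window_periodic[of a n])
  finally have "pair_count (- {k<..<n - k}) P Q + t * n \<le>
      t * q + p * (2 * k + 1) + t * (n - p + t - (2 * k + 1))"
    using correlation_bound[OF le1(1) per(1) suma le1(2) sumb t[folded p_def]] by linarith
  moreover have "p \<le> n"
    unfolding p_def using card_mono[OF _ P] by simp
  moreover have "int (n - p + t - (2 * k + 1)) = int n - int p + int t - (2 * int k + 1)"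
    using t(3) \<open>p \<le> n\<close> by (simp add: p_def)
  ultimately have near: "int (pair_count (- {k<..<n - k}) P Q) + int t * int n \<le>
      int t * int q + int p * (2 * int k + 1) +
      int t * (int n - int p + int t - (2 * int k + 1))"
    by (simp only: of_nat_add of_nat_mult of_nat_numeral of_nat_1 flip: of_nat_le_iff[where 'a = int])
  have "int (pair_count {k<..<n - k} P Q) + int (pair_count (- {k<..<n - k}) P Q) =
      int p * int q"
    unfolding p_def q_def using pair_count_complement[OF fin, of "{k<..<n - k}"]
    by (simp only: flip: of_nat_add of_nat_mult)
  moreover have "(int p - int t) * (int q - (2 * int k + 1) + int t) = int p * int q
      - (int t * int q + int p * (2 * int k + 1) + int t * (int n - int p + int t - (2 * int k + 1)))
      + int t * int n"
    by (simp add: algebra_simps)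
  ultimately show ?thesis
    unfolding p_def[symmetric] q_def[symmetric] using near by linarith
qed

section \<open>Centred intervals attain the bounds\<close>

text \<open>
  Writing \<open>\<alpha> = a - c\<close> and \<open>\<beta> = (c + q) - (a + p)\<close> for the two overhangs of the outer interval, there
  are at most \<open>max 0 (p + \<beta> - d)\<close> pairs with the partner to the right and at most
  \<open>max 0 (p + \<alpha> - d)\<close> with the partner to the left. Since \<open>\<alpha>\<close> and \<open>\<beta>\<close> differ by at most one, one of
  these terms can be negative only if the other one is at most \<open>0\<close>, so that their sum is
  \<open>max 0 (2 p + \<alpha> + \<beta> - 2 d) = max 0 (p + q - 2 d)\<close>.
\<close>

lemma pair_count_centred_le:
  assumes "1 \<le> d" "p \<le> q" "centred a p c q"
  shows "pair_count {d} {a..<a + p} {c..<c + q} \<le> p + q - 2 * d"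
proof -
  have "card {i \<in> {a..<a + p}. i + d \<in> {c..<c + q}} \<le> card {a..<c + q - d}"
    by (intro card_mono) auto
  moreover have "card {i \<in> {a..<a + p}. d \<le> i \<and> i - d \<in> {c..<c + q}} \<le> card {c + d..<a + p}"
    by (intro card_mono) auto
  moreover have "card {a..<c + q - d} + card {c + d..<a + p} \<le> p + q - 2 * d"
    using assms(2,3) unfolding centred_def card_atLeastLessThan by linarith
  ultimately show ?thesis
    using assms(1) pair_count_single[of "{a..<a + p}" "{c..<c + q}" d] by simp
qed

lemma sum_arithmetic_progression:
  assumes "k \<le> e" "2 * e \<le> s"
  shows "int (\<Sum>d\<in>{k<..e}. s - 2 * d) = (int e - int k) * (int s - int k - 1 - int e)"
  using assms
proof (induction e rule: dec_induct)
  case (step e)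
  have "{k<..Suc e} = insert (Suc e) {k<..e}" using step by auto
  then show ?case using step by (simp add: algebra_simps of_nat_diff)
qed simp

text \<open>
  The last distance \<open>e\<close> is where the range \<open>k < d < n - k\<close> ends or the terms \<open>p + q - 2 d\<close> become
  negative, whichever comes first.
\<close>

lemma centred_far_le_progression:
  assumes "k \<le> e" "e = min (n - k - 1) ((p + q) div 2)" "p \<le> q" "centred a p c q"
  shows "int (pair_count {k<..<n - k} {a..<a + p} {c..<c + q}) \<le>
    (int e - int k) * (int (p + q) - int k - 1 - int e)"
proof -
  have "pair_count {k<..<n - k} {a..<a + p} {c..<c + q} \<le> (\<Sum>d\<in>{k<..<n - k}. p + q - 2 * d)"
    unfolding pair_count_by_distance[OF finite_greaterThanLessThan]
    using assms(3,4) by (intro sum_mono pair_count_centred_le) auto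
  also have "\<dots> = (\<Sum>d\<in>{k<..e}. p + q - 2 * d)"
  proof (rule sum.mono_neutral_right)
    show "{k<..e} \<subseteq> {k<..<n - k}"
      using assms(1,2) by (simp add: subset_iff) linarith
    show "\<forall>d\<in>{k<..<n - k} - {k<..e}. p + q - 2 * d = 0"
    proof
      fix d assume "d \<in> {k<..<n - k} - {k<..e}"
      then have "d \<le> n - k - 1" "e < d" by auto
      then have "(p + q) div 2 < d" using assms(2) by (simp add: min_def split: if_splits)
      then show "p + q - 2 * d = 0" by linarith
    qed
  qed simp
  finally have "int (pair_count {k<..<n - k} {a..<a + p} {c..<c + q}) \<le>
      int (\<Sum>d\<in>{k<..e}. p + q - 2 * d)"
    by (simp only: of_nat_le_iff)
  also have "\<dots> = (int e - int k) * (int (p + q) - int k - 1 - int e)"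
  proof (rule sum_arithmetic_progression[OF assms(1)])
    have "e \<le> (p + q) div 2" unfolding assms(2) by (rule min.cobounded2)
    then show "2 * e \<le> p + q" by linarith
  qed
  finally show ?thesis .
qed

text \<open>
  If \<open>Q\<close> exceeds \<open>P\<close> by more than \<open>k\<close> on both sides, the \<open>2 k + 1\<close> positions closest to each
  element of \<open>P\<close> all belong to \<open>Q\<close>. In this range the bound \<open>p + q - 2 d\<close> on the single distances is
  not sharp for small \<open>d\<close>, where the count is only \<open>2 p\<close>, so the complement is counted instead.
\<close>

lemma centred_far_le_product:
  assumes "p + (2 * k + 2) \<le> q" "centred a p c q"
  shows "int (pair_count {k<..<n - k} {a..<a + p} {c..<c + q}) \<le> int p * (int q - (2 * int k + 1))"
proof -
  let ?P = "{a..<a + p}" and ?Q = "{c..<c + q}"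
  have "2 * k + 1 \<le> (\<Sum>j\<in>?Q. of_bool (gap i j \<in> - {k<..<n - k}))" if "i \<in> ?P" for i
  proof -
    have "{i - k..i + k} \<subseteq> {j \<in> ?Q. gap i j \<in> - {k<..<n - k}}"
      using that assms by (auto simp: gap_def centred_def)
    then have "card {i - k..i + k} \<le> card {j \<in> ?Q. gap i j \<in> - {k<..<n - k}}"
      by (intro card_mono) auto
    moreover have "k \<le> i" using that assms by (simp add: centred_def)
    ultimately show ?thesis by (simp add: sum_of_bool_eq Int_def)
  qed
  then have "(\<Sum>i\<in>?P. 2 * k + 1) \<le> pair_count (- {k<..<n - k}) ?P ?Q"
    unfolding pair_count_def by (intro sum_mono)
  then have "p * (2 * k + 1) \<le> pair_count (- {k<..<n - k}) ?P ?Q"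
    by simp
  then have "pair_count {k<..<n - k} ?P ?Q + p * (2 * k + 1) \<le> p * q"
    using pair_count_complement[of ?P ?Q "{k<..<n - k}"] by simp
  then have "int (pair_count {k<..<n - k} ?P ?Q + p * (2 * k + 1)) \<le> int (p * q)"
    by (simp only: of_nat_le_iff)
  then show ?thesis by (simp add: algebra_simps)
qed

text \<open>
  The threshold \<open>t\<close> is found by matching factors: \<open>(p - t) (q - (2 k + 1) + t)\<close> equals the sum
  \<open>(e - k) (p + q - k - 1 - e)\<close> of the progression for \<open>t = p + k - e\<close>. This threshold is
  legitimate if \<open>k \<le> e\<close> and \<open>q \<le> p + 2 k + 1\<close>. For \<open>e < k\<close> the centred intervals have no far pairs at
  all, and if \<open>q\<close> exceeds \<open>p\<close> by more than \<open>2 k + 1\<close>, then \<open>t = 0\<close> is the right choice.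
\<close>

lemma centred_minimises_far:
  assumes PQ: "P \<subseteq> {..<n}" "Q \<subseteq> {..<n}" and k: "2 * k + 1 \<le> n"
    and cards: "card P = p" "card Q = q" "p \<le> q" and cen: "centred a p c q"
  shows "pair_count {k<..<n - k} {a..<a + p} {c..<c + q} \<le> pair_count {k<..<n - k} P Q"
proof -
  have "q \<le> n" using card_mono[OF _ PQ(2)] cards by simp
  define e where "e = min (n - k - 1) ((p + q) div 2)"
  consider (wide) "p + (2 * k + 2) \<le> q" | (empty) "e < k" | (main) "q \<le> p + 2 * k + 1" "k \<le> e"
    by linarith
  then show ?thesis
  proof cases
    case wide
    then have "int p * (int q - (2 * int k + 1)) \<le> int (pair_count {k<..<n - k} P Q)"
      using pair_count_far_ge[OF PQ k, of 0] \<open>q \<le> n\<close> unfolding cards(1,2) by simp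
    then show ?thesis
      using centred_far_le_product[OF wide cen, of n] by linarith
  next
    case empty
    then have "p + q - 2 * d = 0" if "k < d" for d
      using that k by (simp add: e_def)
    then have "pair_count {d} {a..<a + p} {c..<c + q} = 0" if "k < d" for d
      using pair_count_centred_le[of d p q a c] that cards(3) cen by simp
    then show ?thesis
      by (subst pair_count_by_distance) simp_all
  next
    case main
    define t where "t = p + k - e"
    have e: "e \<le> p + k" "e + k + 1 \<le> n" "p \<le> e + k + 1"
      using main k cards(3) \<open>q \<le> n\<close> unfolding e_def by linarith+
    then have t: "int t = int p + int k - int e" "t \<le> p" "t \<le> 2 * k + 1" "2 * k + 1 \<le> n - p + t"
      using main(2) \<open>q \<le> n\<close> cards(3) unfolding t_def by linarith+
    then have "(int p - int t) * (int q - (2 * int k + 1) + int t) \<le>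
        int (pair_count {k<..<n - k} P Q)"
      using pair_count_far_ge[OF PQ k, of t] unfolding cards(1,2) by blast
    moreover have "(int p - int t) * (int q - (2 * int k + 1) + int t) =
        (int e - int k) * (int (p + q) - int k - 1 - int e)"
      by (simp add: t(1))
    ultimately show ?thesis
      using centred_far_le_progression[OF main(2) e_def cards(3) cen] by linarith
  qed
qed

lemma centred_minimises_long:
  assumes "P \<subseteq> {..<n}" "Q \<subseteq> {..<n}" "1 \<le> d" "d \<le> n" "n \<le> 2 * d"
    and "card P = p" "card Q = q" "p \<le> q" "centred a p c q"
  shows "pair_count {d} {a..<a + p} {c..<c + q} \<le> pair_count {d} P Q"
  using pair_count_long_ge[of P n Q d] pair_count_centred_le[of d p q a c] assms by linarith

section \<open>Up-benevolent weights\<close>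

text \<open>
  For \<open>d > 0\<close> let \<open>m = min d (n - d)\<close> be the circular distance. Then \<open>k < d < n - k\<close> means \<open>k < m\<close>, so
  the first sum telescopes to \<open>\<phi> m - \<phi> 1\<close>, while the second one supplies \<open>\<phi> d - \<phi> (n - d)\<close> for
  \<open>d > n/2\<close>. For up-benevolent weights all coefficients except \<open>\<phi> 1\<close> are non-negative.
\<close>

lemma weight_decomposition:
  fixes \<phi> :: "nat \<Rightarrow> real"
  assumes "\<phi> 0 = 0" "d < n"
  shows "\<phi> d = \<phi> 1 * (1 - of_bool (d = 0))
    + (\<Sum>k\<in>{1..<n div 2}. (\<phi> (Suc k) - \<phi> k) * of_bool (d \<in> {k<..<n - k}))
    + (\<Sum>D\<in>{n div 2<..<n}. (\<phi> D - \<phi> (n - D)) * of_bool (d = D))"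
proof (cases "d = 0")
  case True
  then show ?thesis using assms(1) by simp
next
  case False
  define m where "m = min d (n - d)"
  have m: "1 \<le> m" "m \<le> n div 2" using False assms(2) by (auto simp: m_def)
  have "(\<Sum>k\<in>{1..<n div 2}. (\<phi> (Suc k) - \<phi> k) * of_bool (d \<in> {k<..<n - k})) =
      (\<Sum>k\<in>{1..<m}. \<phi> (Suc k) - \<phi> k)"
    using m by (intro sum.mono_neutral_cong_right) (auto simp: m_def)
  also have "\<dots> = \<phi> m - \<phi> 1"
    using m by (intro sum_Suc_diff') simp
  finally have steps: "(\<Sum>k\<in>{1..<n div 2}. (\<phi> (Suc k) - \<phi> k) * of_bool (d \<in> {k<..<n - k})) =
      \<phi> m - \<phi> 1" .
  have "(\<Sum>D\<in>{n div 2<..<n}. (\<phi> D - \<phi> (n - D)) * of_bool (d = D)) =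
      (\<Sum>D\<in>{n div 2<..<n}. if d = D then \<phi> D - \<phi> (n - D) else 0)"
    by (intro sum.cong) auto
  also have "\<dots> = (if n div 2 < d then \<phi> d - \<phi> (n - d) else 0)"
    using assms(2) by simp
  also have "\<dots> = \<phi> d - \<phi> m"
  proof (cases "n div 2 < d")
    case True
    then have "m = n - d" by (simp add: m_def)
    then show ?thesis using True by simp
  next
    case False
    then have "m = d" by (simp add: m_def)
    then show ?thesis using False by simp
  qed
  finally show ?thesis using steps False by simp
qed

text \<open>
  The inclusion \<open>P \<subseteq> Q\<close> makes the diagonal term depend on the cardinalities alone, so that it
  cancels when two pairs of sets of the same sizes are compared, whatever the sign of \<open>\<phi> 1\<close>.
\<close>

lemma pair_sum_decomposition:
  fixes \<phi> :: "nat \<Rightarrow> real"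
  assumes "\<phi> 0 = 0" "P \<subseteq> Q" "Q \<subseteq> {..<n}"
  shows "(\<Sum>i\<in>P. \<Sum>j\<in>Q. \<phi> (gap i j)) = \<phi> 1 * (real (card P) * real (card Q) - real (card P))
    + (\<Sum>k\<in>{1..<n div 2}. (\<phi> (Suc k) - \<phi> k) * real (pair_count {k<..<n - k} P Q))
    + (\<Sum>D\<in>{n div 2<..<n}. (\<phi> D - \<phi> (n - D)) * real (pair_count {D} P Q))"
proof -
  have fin: "finite P" "finite Q" using assms by (meson finite_lessThan finite_subset)+
  have count: "(\<Sum>i\<in>P. \<Sum>j\<in>Q. \<Sum>k\<in>K. w k * of_bool (gap i j \<in> S k)) =
      (\<Sum>k\<in>K. w k * real (pair_count (S k) P Q))" for w :: "nat \<Rightarrow> real" and S K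
  proof -
    have "(\<Sum>i\<in>P. \<Sum>j\<in>Q. \<Sum>k\<in>K. w k * of_bool (gap i j \<in> S k)) =
        (\<Sum>i\<in>P. \<Sum>k\<in>K. \<Sum>j\<in>Q. w k * of_bool (gap i j \<in> S k))"
      by (intro sum.cong refl sum.swap)
    also have "\<dots> = (\<Sum>k\<in>K. \<Sum>i\<in>P. \<Sum>j\<in>Q. w k * of_bool (gap i j \<in> S k))"
      by (rule sum.swap)
    finally show ?thesis
      by (simp only: pair_count_def of_nat_sum of_nat_of_bool sum_distrib_left)
  qed
  have diag: "(\<Sum>i\<in>P. \<Sum>j\<in>Q. \<phi> 1 * (1 - of_bool (gap i j = 0))) =
      \<phi> 1 * (real (card P) * real (card Q) - real (card P))"
  proof -
    have "(\<Sum>j\<in>Q. of_bool (gap i j = 0)) = (1 :: real)" if "i \<in> P" for i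
    proof -
      have "(\<Sum>j\<in>Q. of_bool (gap i j = 0)) = (\<Sum>j\<in>Q. if i = j then 1 else 0 :: real)"
        by (intro sum.cong) (auto simp: gap_def)
      then show ?thesis using that assms fin by auto
    qed
    then show ?thesis
      by (simp add: sum_subtractf algebra_simps flip: sum_distrib_left)
  qed
  have "(\<Sum>i\<in>P. \<Sum>j\<in>Q. \<phi> (gap i j)) = (\<Sum>i\<in>P. \<Sum>j\<in>Q. \<phi> 1 * (1 - of_bool (gap i j = 0))
    + (\<Sum>k\<in>{1..<n div 2}. (\<phi> (Suc k) - \<phi> k) * of_bool (gap i j \<in> {k<..<n - k}))
    + (\<Sum>D\<in>{n div 2<..<n}. (\<phi> D - \<phi> (n - D)) * of_bool (gap i j \<in> {D})))"
  proof (intro sum.cong refl)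
    fix i j assume "i \<in> P" "j \<in> Q"
    then have "i < n" "j < n" using assms by auto
    then have "gap i j < n" by (simp add: gap_def)
    then show "\<phi> (gap i j) = \<phi> 1 * (1 - of_bool (gap i j = 0))
      + (\<Sum>k\<in>{1..<n div 2}. (\<phi> (Suc k) - \<phi> k) * of_bool (gap i j \<in> {k<..<n - k}))
      + (\<Sum>D\<in>{n div 2<..<n}. (\<phi> D - \<phi> (n - D)) * of_bool (gap i j \<in> {D}))"
      unfolding singleton_iff by (rule weight_decomposition[of \<phi>, OF assms(1)])
  qed
  also have "\<dots> = (\<Sum>i\<in>P. \<Sum>j\<in>Q. \<phi> 1 * (1 - of_bool (gap i j = 0)))
    + (\<Sum>i\<in>P. \<Sum>j\<in>Q. \<Sum>k\<in>{1..<n div 2}. (\<phi> (Suc k) - \<phi> k) * of_bool (gap i j \<in> {k<..<n - k}))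
    + (\<Sum>i\<in>P. \<Sum>j\<in>Q. \<Sum>D\<in>{n div 2<..<n}. (\<phi> D - \<phi> (n - D)) * of_bool (gap i j \<in> {D}))"
    by (simp only: sum.distrib)
  finally show ?thesis
    by (simp only: diag count)
qed

lemma centred_minimises_pair_sum:
  fixes \<phi> :: "nat \<Rightarrow> real"
  assumes zero: "\<phi> 0 = 0"
    and mono: "\<And>k. 1 \<le> k \<Longrightarrow> k < n div 2 \<Longrightarrow> \<phi> k \<le> \<phi> (Suc k)"
    and long: "\<And>d. n div 2 < d \<Longrightarrow> d < n \<Longrightarrow> \<phi> (n - d) \<le> \<phi> d"
    and PQ: "P \<subseteq> Q" "Q \<subseteq> {..<n}" "card P = p" "card Q = q"
    and cen: "centred a p c q" and "c + q \<le> n"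
  shows "(\<Sum>i\<in>{a..<a + p}. \<Sum>j\<in>{c..<c + q}. \<phi> (gap i j)) \<le> (\<Sum>i\<in>P. \<Sum>j\<in>Q. \<phi> (gap i j))"
proof -
  have "p \<le> q" using PQ card_mono[of Q P] finite_subset[of Q "{..<n}"] by auto
  have sub: "{a..<a + p} \<subseteq> {c..<c + q}" "{c..<c + q} \<subseteq> {..<n}"
    using cen \<open>p \<le> q\<close> \<open>c + q \<le> n\<close> by (auto simp: centred_def)
  have P: "P \<subseteq> {..<n}" using PQ by auto
  have "(\<phi> (Suc k) - \<phi> k) * real (pair_count {k<..<n - k} {a..<a + p} {c..<c + q}) \<le>
      (\<phi> (Suc k) - \<phi> k) * real (pair_count {k<..<n - k} P Q)" if "k \<in> {1..<n div 2}" for k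
  proof (rule mult_left_mono)
    have "pair_count {k<..<n - k} {a..<a + p} {c..<c + q} \<le> pair_count {k<..<n - k} P Q"
      using that by (intro centred_minimises_far P PQ \<open>p \<le> q\<close> cen) auto
    then show "real (pair_count {k<..<n - k} {a..<a + p} {c..<c + q}) \<le>
        real (pair_count {k<..<n - k} P Q)" by simp
  qed (use mono[of k] that in auto)
  moreover have "(\<phi> d - \<phi> (n - d)) * real (pair_count {d} {a..<a + p} {c..<c + q}) \<le>
      (\<phi> d - \<phi> (n - d)) * real (pair_count {d} P Q)" if "d \<in> {n div 2<..<n}" for d
  proof (rule mult_left_mono)
    have "pair_count {d} {a..<a + p} {c..<c + q} \<le> pair_count {d} P Q"
      using that by (intro centred_minimises_long[OF P] PQ \<open>p \<le> q\<close> cen) auto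
    then show "real (pair_count {d} {a..<a + p} {c..<c + q}) \<le> real (pair_count {d} P Q)"
      by simp
  qed (use long[of d] that in auto)
  ultimately show ?thesis
    unfolding pair_sum_decomposition[of \<phi>, OF zero sub] pair_sum_decomposition[of \<phi>, OF zero PQ(1,2)]
    by (intro add_mono sum_mono) (simp_all add: PQ)
qed

section \<open>The generators of the cone\<close>

lemma filter_odd_upt: "filter odd [1..<n + 1] = map (\<lambda>m. 2 * m + 1) [0..<(n + 1) div 2]"
  by (induction n) (auto elim!: oddE evenE)

lemma filter_even_upt: "filter even [1..<n + 1] = map (\<lambda>m. 2 * m + 2) [0..<n div 2]"
  by (induction n) (auto elim!: oddE evenE)

lemma supnick_perm_eq:
  assumes "1 \<le> i" "i \<le> n"
  shows "supnick_perm n i = (if i \<le> (n + 1) div 2 then 2 * i - 1 else 2 * (n - i + 1))"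
proof (cases "i \<le> (n + 1) div 2")
  case True
  then have "i - 1 < (n + 1) div 2" using assms by linarith
  then have "supnick_perm n i = 2 * (i - 1) + 1"
    unfolding supnick_perm_def of_sequence_def filter_odd_upt filter_even_upt
    by (simp add: nth_append)
  then show ?thesis using True assms by simp
next
  case False
  define m where "m = i - 1 - (n + 1) div 2"
  have m: "\<not> i - 1 < (n + 1) div 2" "m < n div 2" "n div 2 - Suc m = n - i" "n - i < n div 2"
    using False assms unfolding m_def by linarith+
  have "supnick_perm n i = rev (map (\<lambda>m. 2 * m + 2) [0..<n div 2]) ! m"
    unfolding supnick_perm_def of_sequence_def filter_odd_upt filter_even_upt m_def
    using m(1) by (simp add: nth_append)
  also have "\<dots> = 2 * (n - i) + 2"
    using m(2-4) by (simp add: rev_nth)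
  finally show ?thesis using False by simp
qed

lemma shift_perm_eq:
  assumes "1 \<le> u" "u \<le> n" "1 \<le> i" "i \<le> n"
  shows "shift_perm n u i = (if i + u \<le> n + 1 then i + u - 1 else i + u - 1 - n)"
proof (cases "i + u \<le> n + 1")
  case True
  then have "i - 1 < n + 1 - u" using assms by linarith
  then show ?thesis using True assms by (simp add: shift_perm_def of_sequence_def nth_append del: upt_Suc)
next
  case False
  then have "\<not> i - 1 < n + 1 - u" "i - 1 - (n + 1 - u) < u - 1" using assms by linarith+
  then show ?thesis using False assms by (simp add: shift_perm_def of_sequence_def nth_append del: upt_Suc)
qed

text \<open>
  The large values of the Supnick permutation sit in the middle of the sequence: before them come the
  small odd numbers, after them the small even ones.
\<close>

lemma supnick_perm_large_iff:
  assumes "1 \<le> i" "i \<le> n" "p \<le> n"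
  shows "n - p + 1 \<le> supnick_perm n i \<and> supnick_perm n i \<le> n \<longleftrightarrow>
    (n - p + 1) div 2 + 1 \<le> i \<and> i \<le> n - (n - p) div 2"
proof (cases "i \<le> (n + 1) div 2")
  case True
  then have "supnick_perm n i = 2 * i - 1" using assms by (simp add: supnick_perm_eq)
  then show ?thesis using True assms by (safe; linarith)
next
  case False
  define e where "e = n - i"
  have n: "n = i + e" using assms(2) by (simp add: e_def)
  have v: "supnick_perm n i = 2 * e + 2" using False assms by (simp add: supnick_perm_eq e_def)
  have "(n - p + 1) div 2 + 1 \<le> i" "2 * e + 2 \<le> n"
    using False n by linarith+
  moreover have "n - p + 1 \<le> 2 * e + 2 \<longleftrightarrow> (n - p) div 2 \<le> e"
    by linarith
  moreover have "(n - p) div 2 \<le> e \<longleftrightarrow> i \<le> n - (n - p) div 2"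
    using n by linarith
  ultimately show ?thesis unfolding v by blast
qed

lemma admissible_shift_iff:
  assumes "1 \<le> u" "u \<le> n" "q \<le> n"
  shows "admissible_shift n q u \<longleftrightarrow> u \<le> (n - q + 1) div 2 + 1 \<or> n - (n - q) div 2 + 1 \<le> u"
proof -
  have "\<lceil>(real n - real q) / 2\<rceil> = int ((n - q + 1) div 2)"
  proof (rule ceiling_unique)
    have "n - q \<le> 2 * ((n - q + 1) div 2)" "2 * ((n - q + 1) div 2) < n - q + 2" by linarith+
    then have "real (n - q) \<le> 2 * real ((n - q + 1) div 2)"
      "2 * real ((n - q + 1) div 2) < real (n - q) + 2" by linarith+
    then show "real_of_int (int ((n - q + 1) div 2)) - 1 < (real n - real q) / 2"
      "(real n - real q) / 2 \<le> real_of_int (int ((n - q + 1) div 2))"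
      using assms(3) by (simp_all add: of_nat_diff)
  qed
  moreover have "\<lfloor>(real n - real q) / 2\<rfloor> = int ((n - q) div 2)"
  proof (rule floor_unique)
    have "2 * ((n - q) div 2) \<le> n - q" "n - q < 2 * ((n - q) div 2) + 2" by linarith+
    then have "2 * real ((n - q) div 2) \<le> real (n - q)"
      "real (n - q) < 2 * real ((n - q) div 2) + 2" by linarith+
    then show "real_of_int (int ((n - q) div 2)) \<le> (real n - real q) / 2"
      "(real n - real q) / 2 < real_of_int (int ((n - q) div 2)) + 1"
      using assms(3) by (simp_all add: of_nat_diff)
  qed
  ultimately show ?thesis
    using assms unfolding admissible_shift_def by auto
qed

text \<open>
  The positions at which a permuted \<open>R_matrix\<close> has its non-zero rows. They are counted from \<open>0\<close>,
  as is convenient for residues modulo \<open>n\<close>, whereas matrix indices start at \<open>1\<close>; hence the \<open>Suc\<close>.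
\<close>

definition top_positions :: "nat \<Rightarrow> nat \<Rightarrow> (nat \<Rightarrow> nat) \<Rightarrow> nat set" where
  "top_positions n p \<rho> = {i. i < n \<and> n - p + 1 \<le> \<rho> (Suc i) \<and> \<rho> (Suc i) \<le> n}"

lemma mem_top_positions_supnick_shift:
  assumes "1 \<le> u" "u \<le> n" "p \<le> n" "i < n"
  shows "i \<in> top_positions n p (supnick_perm n \<circ> shift_perm n u) \<longleftrightarrow>
    (if i + u \<le> n then (n - p + 1) div 2 + 1 \<le> i + u \<and> i + u \<le> n - (n - p) div 2
     else (n - p + 1) div 2 + 1 + n \<le> i + u \<and> i + u \<le> n - (n - p) div 2 + n)"
proof -
  have s: "shift_perm n u (Suc i) = (if i + u \<le> n then i + u else i + u - n)"
    using shift_perm_eq[of u n "Suc i"] assms by auto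
  show ?thesis
  proof (cases "i + u \<le> n")
    case True
    then show ?thesis
      using supnick_perm_large_iff[of "i + u" n p] s assms by (simp add: top_positions_def)
  next
    case False
    then have "1 \<le> i + u - n" "i + u - n \<le> n" using assms by linarith+
    then have "i \<in> top_positions n p (supnick_perm n \<circ> shift_perm n u) \<longleftrightarrow>
        (n - p + 1) div 2 + 1 \<le> i + u - n \<and> i + u - n \<le> n - (n - p) div 2"
      using supnick_perm_large_iff[of "i + u - n" n p] s assms False by (simp add: top_positions_def)
    moreover have "i + u - n \<le> h \<longleftrightarrow> i + u \<le> h + n" "l \<le> i + u - n \<longleftrightarrow> l + n \<le> i + u" for h l
      using False by linarith+
    ultimately show ?thesis using False by (simp only: if_False)
  qed
qed

text \<open>
  Admissibility of the shift means that the interval \<open>{lo q..hi q}\<close> of large values is moved as a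
  whole, either to the left by \<open>u - 1\<close> or to the right by \<open>n - u + 1\<close>. The nested interval
  \<open>{lo p..hi p}\<close> moves with it, which preserves the relative position of the midpoints.
\<close>

lemma top_positions_centred_intervals:
  assumes "p \<le> q" "q \<le> n" "1 \<le> u" "u \<le> n" "admissible_shift n q u"
  obtains a c where
    "top_positions n p (supnick_perm n \<circ> shift_perm n u) = {a..<a + p}"
    "top_positions n q (supnick_perm n \<circ> shift_perm n u) = {c..<c + q}"
    "centred a p c q" "c + q \<le> n"
proof -
  define lo hi where "lo r = (n - r + 1) div 2 + 1" and "hi r = n - (n - r) div 2" for r
  have size: "hi r + 1 = lo r + r" if "r \<le> n" for r
    using that unfolding lo_def hi_def by linarith
  \<comment> \<open>Up to rounding, \<open>2 * lo r + r\<close> does not depend on \<open>r\<close>: all these intervals have the same midpoint.\<close>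
  have twice: "n + 2 \<le> 2 * lo r + r" "2 * lo r + r \<le> n + 3" if "r \<le> n" for r
  proof -
    have "n - r \<le> 2 * ((n - r + 1) div 2)" "2 * ((n - r + 1) div 2) \<le> n - r + 1" by linarith+
    then show "n + 2 \<le> 2 * lo r + r" "2 * lo r + r \<le> n + 3"
      using that unfolding lo_def by simp_all
  qed
  have nested: "lo q \<le> lo p" "hi p \<le> hi q" "2 * lo p + p \<le> 2 * lo q + q + 1"
    "2 * lo q + q \<le> 2 * lo p + p + 1"
  proof -
    show "lo q \<le> lo p" "hi p \<le> hi q"
      using assms(1,2) unfolding lo_def hi_def by linarith+
    show "2 * lo p + p \<le> 2 * lo q + q + 1" "2 * lo q + q \<le> 2 * lo p + p + 1"
      using twice[of p] twice[of q] assms(1,2) by simp_all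
  qed
  have hi_le: "hi q \<le> n" by (simp add: hi_def)
  have mem: "i \<in> top_positions n r (supnick_perm n \<circ> shift_perm n u) \<longleftrightarrow> i < n \<and>
      (if i + u \<le> n then lo r \<le> i + u \<and> i + u \<le> hi r else lo r + n \<le> i + u \<and> i + u \<le> hi r + n)"
    if "r \<le> n" for i r
    using mem_top_positions_supnick_shift[of u n r i] assms that
    unfolding lo_def hi_def by (auto simp: top_positions_def)
  have "p \<le> n" using assms by simp
  consider "u \<le> lo q" | "hi q + 1 \<le> u"
    using assms(5) admissible_shift_iff[of u n q] assms by (auto simp: lo_def hi_def)
  then show thesis
  proof cases
    case 1
    have "top_positions n r (supnick_perm n \<circ> shift_perm n u) = {lo r - u..<lo r - u + r}"
      if "r = p \<or> r = q" for r
    proof -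
      have r: "r \<le> n" "lo q \<le> lo r" "hi r \<le> hi q" using that assms nested by auto
      have "i < n \<and> (if i + u \<le> n then lo r \<le> i + u \<and> i + u \<le> hi r
          else lo r + n \<le> i + u \<and> i + u \<le> hi r + n) \<longleftrightarrow> lo r - u \<le> i \<and> i < lo r - u + r" for i
        using size[OF r(1)] r 1 hi_le assms(3,4) by (cases "i + u \<le> n") (simp_all, linarith+)
      then show ?thesis
        by (intro set_eqI) (simp only: mem[OF r(1)] atLeastLessThan_iff)
    qed
    then have T: "top_positions n p (supnick_perm n \<circ> shift_perm n u) = {lo p - u..<lo p - u + p}"
      "top_positions n q (supnick_perm n \<circ> shift_perm n u) = {lo q - u..<lo q - u + q}"
      by blast+
    obtain a c where ac: "a = lo p - u" "c = lo q - u" by blast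
    then have "lo p = a + u" "lo q = c + u"
      using 1 nested(1) by linarith+
    then have "centred a p c q" "c + q \<le> n"
      using nested(3,4) size[OF assms(2)] hi_le 1 assms(3) unfolding centred_def by linarith+
    then show thesis
      by (rule that[OF T[folded ac]])
  next
    case 2
    have "top_positions n r (supnick_perm n \<circ> shift_perm n u) = {lo r + n - u..<lo r + n - u + r}"
      if "r = p \<or> r = q" for r
    proof -
      have r: "r \<le> n" "lo q \<le> lo r" "hi r \<le> hi q" using that assms nested by auto
      have "i < n \<and> (if i + u \<le> n then lo r \<le> i + u \<and> i + u \<le> hi r
          else lo r + n \<le> i + u \<and> i + u \<le> hi r + n) \<longleftrightarrow>
          lo r + n - u \<le> i \<and> i < lo r + n - u + r" for i
      proof -
        obtain s where s: "s = lo r + n - u" by blast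
        have "lo r + n = s + u" "1 \<le> lo r" using s assms(4) by (simp_all add: lo_def)
        then show ?thesis
          unfolding s[symmetric] using size[OF r(1)] r 2 hi_le
          by (cases "i + u \<le> n") (simp_all only: if_True if_False, (safe; linarith)+)
      qed
      then show ?thesis
        by (intro set_eqI) (simp only: mem[OF r(1)] atLeastLessThan_iff)
    qed
    then have T: "top_positions n p (supnick_perm n \<circ> shift_perm n u) = {lo p + n - u..<lo p + n - u + p}"
      "top_positions n q (supnick_perm n \<circ> shift_perm n u) = {lo q + n - u..<lo q + n - u + q}"
      by blast+
    obtain a c where ac: "a = lo p + n - u" "c = lo q + n - u" by blast
    then have "lo p + n = a + u" "lo q + n = c + u"
      using assms(4) by linarith+
    then have "centred a p c q" "c + q \<le> n"
      using nested(3,4) size[OF assms(2)] hi_le 2 assms(3) unfolding centred_def by linarith+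
    then show thesis
      by (rule that[OF T[folded ac]])
  qed
qed

lemma card_top_positions_permute:
  assumes "\<pi> permutes {1..n}"
  shows "card (top_positions n p (\<rho> \<circ> \<pi>)) = card (top_positions n p \<rho>)"
proof -
  have "\<pi> ` Suc ` top_positions n p (\<rho> \<circ> \<pi>) = Suc ` top_positions n p \<rho>"
  proof (intro equalityI subsetI)
    fix y assume "y \<in> \<pi> ` Suc ` top_positions n p (\<rho> \<circ> \<pi>)"
    then obtain i where i: "i \<in> top_positions n p (\<rho> \<circ> \<pi>)" "y = \<pi> (Suc i)" by auto
    then have "Suc i \<in> {1..n}" by (simp add: top_positions_def)
    then have "y \<in> {1..n}" using i(2) permutes_in_image[OF assms] by blast
    then show "y \<in> Suc ` top_positions n p \<rho>"
      using i by (intro image_eqI[of _ _ "y - 1"]) (auto simp: top_positions_def)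
  next
    fix y assume "y \<in> Suc ` top_positions n p \<rho>"
    then obtain i where i: "i \<in> top_positions n p \<rho>" "y = Suc i" by auto
    then have "y \<in> \<pi> ` {1..n}" unfolding permutes_image[OF assms] by (simp add: top_positions_def)
    then obtain x where "x \<in> {1..n}" "y = \<pi> x" by auto
    then have "x - 1 \<in> top_positions n p (\<rho> \<circ> \<pi>)" "y = \<pi> (Suc (x - 1))"
      using i by (auto simp: top_positions_def)
    then show "y \<in> \<pi> ` Suc ` top_positions n p (\<rho> \<circ> \<pi>)" by blast
  qed
  then have "card (\<pi> ` Suc ` top_positions n p (\<rho> \<circ> \<pi>)) = card (Suc ` top_positions n p \<rho>)"
    by simp
  moreover have "inj_on \<pi> (Suc ` top_positions n p (\<rho> \<circ> \<pi>))"
    using permutes_inj[OF assms] by (rule inj_on_subset) simp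
  ultimately show ?thesis by (simp add: card_image)
qed

lemma top_positions_mono:
  assumes "p \<le> q"
  shows "top_positions n p \<rho> \<subseteq> top_positions n q \<rho>"
  using assms by (auto simp: top_positions_def)

text \<open>
  For \<open>p \<noteq> q\<close> the two summands of \<open>Rbar_matrix\<close> are transposes of each other and \<open>gap\<close> is symmetric,
  hence the factor \<open>2\<close>.
\<close>

lemma qap_cost_generator:
  fixes \<phi> :: "nat \<Rightarrow> real"
  assumes B: "\<And>i j. i < n \<Longrightarrow> j < n \<Longrightarrow> B (Suc i) (Suc j) = \<phi> (gap i j)"
    and \<rho>: "\<rho> = supnick_perm n \<circ> shift_perm n u \<circ> \<pi>"
  shows "qap_cost n (C_matrix n p q u) B \<pi> = (if p = q then 1 else 2) *
    (\<Sum>i\<in>top_positions n p \<rho>. \<Sum>j\<in>top_positions n q \<rho>. \<phi> (gap i j))"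
proof -
  define T where "T p = top_positions n p \<rho>" for p
  define S where "S p q = (\<Sum>i\<in>T p. \<Sum>j\<in>T q. \<phi> (gap i j))" for p q
  have T: "T p \<subseteq> {..<n}" for p by (auto simp: T_def top_positions_def)
  have box: "(\<Sum>i<n. \<Sum>j<n. of_bool (i \<in> T p) * of_bool (j \<in> T q) * \<phi> (gap i j)) = S p q" for p q
  proof -
    have "(\<Sum>j<n. of_bool (i \<in> T p) * of_bool (j \<in> T q) * \<phi> (gap i j)) =
        of_bool (i \<in> T p) * (\<Sum>j\<in>T q. \<phi> (gap i j))" for i
    proof -
      have "(\<Sum>j<n. of_bool (j \<in> T q) * \<phi> (gap i j)) = (\<Sum>j\<in>T q. \<phi> (gap i j))"
        using T by (intro sum.mono_neutral_cong_right) auto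
      then show ?thesis by (simp only: mult.assoc flip: sum_distrib_left)
    qed
    then have "(\<Sum>i<n. \<Sum>j<n. of_bool (i \<in> T p) * of_bool (j \<in> T q) * \<phi> (gap i j)) =
        (\<Sum>i<n. of_bool (i \<in> T p) * (\<Sum>j\<in>T q. \<phi> (gap i j)))"
      by (simp only:)
    also have "\<dots> = S p q"
      unfolding S_def using T by (intro sum.mono_neutral_cong_right) auto
    finally show ?thesis .
  qed
  have sym: "S q p = S p q"
    unfolding S_def by (subst sum.swap) (simp add: gap_def add.commute)
  have R: "R_matrix n p q (\<rho> (Suc i)) (\<rho> (Suc j)) = of_bool (i \<in> T p) * of_bool (j \<in> T q)"
    if "i < n" "j < n" for i j p q
    using that by (simp add: R_matrix_def T_def top_positions_def)
  have "qap_cost n (C_matrix n p q u) B \<pi> =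
      (\<Sum>i<n. \<Sum>j<n. Rbar_matrix n p q (\<rho> (Suc i)) (\<rho> (Suc j)) * \<phi> (gap i j))"
    by (simp add: qap_cost_def C_matrix_def permute_matrix_def sum.atLeast1_atMost_eq B \<rho>)
  also have "\<dots> = (if p = q then 1 else 2) * S p q"
  proof (cases "p = q")
    case True
    then have "(\<Sum>i<n. \<Sum>j<n. Rbar_matrix n p q (\<rho> (Suc i)) (\<rho> (Suc j)) * \<phi> (gap i j)) =
        (\<Sum>i<n. \<Sum>j<n. of_bool (i \<in> T p) * of_bool (j \<in> T q) * \<phi> (gap i j))"
      by (intro sum.cong refl) (simp add: Rbar_matrix_def R)
    then show ?thesis using True box[of p q] by simp
  next
    case False
    then have "(\<Sum>i<n. \<Sum>j<n. Rbar_matrix n p q (\<rho> (Suc i)) (\<rho> (Suc j)) * \<phi> (gap i j)) =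
        (\<Sum>i<n. \<Sum>j<n. of_bool (i \<in> T p) * of_bool (j \<in> T q) * \<phi> (gap i j)
          + of_bool (i \<in> T q) * of_bool (j \<in> T p) * \<phi> (gap i j))"
      by (intro sum.cong refl) (simp only: Rbar_matrix_def R lessThan_iff if_False distrib_right)
    then show ?thesis using False box[of p q] box[of q p] sym by (simp only: sum.distrib if_False)
  qed
  finally show ?thesis by (simp only: S_def T_def)
qed

lemma generator_identity_optimal:
  fixes \<phi> :: "nat \<Rightarrow> real"
  assumes B: "\<And>i j. i < n \<Longrightarrow> j < n \<Longrightarrow> B (Suc i) (Suc j) = \<phi> (gap i j)"
    and zero: "\<phi> 0 = 0"
    and mono: "\<And>k. 1 \<le> k \<Longrightarrow> k < n div 2 \<Longrightarrow> \<phi> k \<le> \<phi> (Suc k)"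
    and long: "\<And>d. n div 2 < d \<Longrightarrow> d < n \<Longrightarrow> \<phi> (n - d) \<le> \<phi> d"
    and "(p, q, u) \<in> admissible_triples n" and \<pi>: "\<pi> permutes {1..n}"
  shows "qap_cost n (C_matrix n p q u) B id \<le> qap_cost n (C_matrix n p q u) B \<pi>"
proof -
  let ?\<rho> = "supnick_perm n \<circ> shift_perm n u"
  have pqu: "p \<le> q" "q \<le> n" "1 \<le> u" "u \<le> n" "admissible_shift n q u"
    using assms(5) by (auto simp: admissible_triples_def)
  obtain a c where ac: "top_positions n p ?\<rho> = {a..<a + p}" "top_positions n q ?\<rho> = {c..<c + q}"
    "centred a p c q" "c + q \<le> n"
    using top_positions_centred_intervals[OF pqu] by blast
  let ?P = "top_positions n p (?\<rho> \<circ> \<pi>)" and ?Q = "top_positions n q (?\<rho> \<circ> \<pi>)"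
  have "card ?P = p" "card ?Q = q"
    unfolding card_top_positions_permute[OF \<pi>] ac by simp_all
  moreover have "?P \<subseteq> ?Q"
    by (rule top_positions_mono[OF pqu(1)])
  moreover have "?Q \<subseteq> {..<n}"
    by (auto simp: top_positions_def)
  ultimately have le: "(\<Sum>i\<in>{a..<a + p}. \<Sum>j\<in>{c..<c + q}. \<phi> (gap i j)) \<le>
      (\<Sum>i\<in>?P. \<Sum>j\<in>?Q. \<phi> (gap i j))"
    using centred_minimises_pair_sum[of \<phi> n ?P ?Q p q a c] zero mono long ac(3,4) by blast
  have "qap_cost n (C_matrix n p q u) B id = (if p = q then 1 else 2) *
      (\<Sum>i\<in>{a..<a + p}. \<Sum>j\<in>{c..<c + q}. \<phi> (gap i j))"
    using qap_cost_generator[of n B \<phi> ?\<rho> u id p q, OF B] unfolding ac(1,2) by simp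
  also have "\<dots> \<le> (if p = q then 1 else 2) * (\<Sum>i\<in>?P. \<Sum>j\<in>?Q. \<phi> (gap i j))"
    by (rule mult_left_mono[OF le]) simp
  also have "\<dots> = qap_cost n (C_matrix n p q u) B \<pi>"
    using qap_cost_generator[of n B \<phi> "?\<rho> \<circ> \<pi>" u \<pi> p q, OF B] by simp
  finally show ?thesis .
qed

section \<open>Optimality of the identity\<close>

lemma qap_cost_conic_combination:
  assumes "\<pi> permutes {1..n}"
    and "\<forall>i\<in>{1..n}. \<forall>j\<in>{1..n}. A i j = (\<Sum>t\<in>T. c t * M t i j)"
  shows "qap_cost n A B \<pi> = (\<Sum>t\<in>T. c t * qap_cost n (M t) B \<pi>)"
proof -
  have "qap_cost n A B \<pi> = (\<Sum>i=1..n. \<Sum>j=1..n. \<Sum>t\<in>T. c t * (M t (\<pi> i) (\<pi> j) * B i j))"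
    unfolding qap_cost_def
  proof (intro sum.cong refl)
    fix i j assume "i \<in> {1..n}" "j \<in> {1..n}"
    then have "\<pi> i \<in> {1..n}" "\<pi> j \<in> {1..n}"
      using permutes_in_image[OF assms(1)] by blast+
    then show "A (\<pi> i) (\<pi> j) * B i j = (\<Sum>t\<in>T. c t * (M t (\<pi> i) (\<pi> j) * B i j))"
      using assms(2) by (simp add: sum_distrib_right mult.assoc)
  qed
  also have "\<dots> = (\<Sum>i=1..n. \<Sum>t\<in>T. \<Sum>j=1..n. c t * (M t (\<pi> i) (\<pi> j) * B i j))"
    by (intro sum.cong refl sum.swap)
  also have "\<dots> = (\<Sum>t\<in>T. \<Sum>i=1..n. \<Sum>j=1..n. c t * (M t (\<pi> i) (\<pi> j) * B i j))"
    by (rule sum.swap)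
  finally show ?thesis by (simp only: qap_cost_def sum_distrib_left)
qed

text \<open>
  Symmetry of the matrix reduces the generating function to its values at non-negative arguments. The
  conditions up to \<open>\<lceil>(n - 1) / 2\<rceil> = n div 2\<close> become conditions on either side of \<open>n div 2\<close>; the
  second family is indexed by the larger of the two distances \<open>d\<close> and \<open>n - d\<close>.
\<close>

lemma up_benevolent_toeplitz_weight:
  assumes "up_benevolent_toeplitz_matrix n B"
  obtains \<phi> :: "nat \<Rightarrow> real" where
    "\<And>i j. i < n \<Longrightarrow> j < n \<Longrightarrow> B (Suc i) (Suc j) = \<phi> (gap i j)"
    "\<phi> 0 = 0"
    "\<And>k. 1 \<le> k \<Longrightarrow> k < n div 2 \<Longrightarrow> \<phi> k \<le> \<phi> (Suc k)"
    "\<And>d. n div 2 < d \<Longrightarrow> d < n \<Longrightarrow> \<phi> (n - d) \<le> \<phi> d"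
proof -
  obtain f where sym: "symmetric_matrix n B" and toep: "toeplitz_matrix n f B"
    and ben: "up_benevolent n f"
    using assms by (auto simp: up_benevolent_toeplitz_matrix_def)
  have half: "int (n div 2) \<le> \<lceil>(real n - 1) / 2\<rceil>"
  proof -
    have "2 * (n div 2) \<le> n" by simp
    then have "2 * real (n div 2) \<le> real n" by linarith
    then have "real (n div 2) - 1 < (real n - 1) / 2" by simp
    then show ?thesis by (simp add: le_ceiling_iff)
  qed
  have B: "B (Suc i) (Suc j) = f (int i - int j)" if "i < n" "j < n" for i j
    using that toep by (simp add: toeplitz_matrix_def)
  show thesis
  proof (rule that[of "\<lambda>d. f (int d)"])
    show "B (Suc i) (Suc j) = f (int (gap i j))" if "i < n" "j < n" for i j
    proof (cases "j \<le> i")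
      case True
      then show ?thesis using B[OF that] by (simp add: gap_def of_nat_diff)
    next
      case False
      have "B (Suc i) (Suc j) = B (Suc j) (Suc i)"
        using sym that by (simp add: symmetric_matrix_def)
      then show ?thesis using False B[OF that(2,1)] by (simp add: gap_def of_nat_diff)
    qed
    show "f (int 0) = 0" using ben by (simp add: up_benevolent_def)
    show "f (int k) \<le> f (int (Suc k))" if "1 \<le> k" "k < n div 2" for k
    proof -
      have "1 \<le> int k" "int k + 1 \<le> \<lceil>(real n - 1) / 2\<rceil>" using that half by linarith+
      then have "f (int k) \<le> f (int k + 1)" using ben by (simp add: up_benevolent_def)
      then show ?thesis by (simp add: add.commute)
    qed
    show "f (int (n - d)) \<le> f (int d)" if "n div 2 < d" "d < n" for d
    proof -
      have "1 \<le> int (n - d)" "int (n - d) \<le> \<lceil>(real n - 1) / 2\<rceil>" using that half by linarith+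
      then have "f (int (n - d)) \<le> f (int n - int (n - d))"
        using ben unfolding up_benevolent_def by blast
      then show ?thesis using that by (simp add: of_nat_diff)
    qed
  qed
qed

theorem theorem3p7:
  fixes n :: nat and A B :: matrix
  assumes "n \<ge> 1"
    and "PS_monotone_anti_Monge n A"
    and "up_benevolent_toeplitz_matrix n B"
  shows "qap_optimal n A B id"
proof -
  obtain \<phi> :: "nat \<Rightarrow> real" where \<phi>:
    "\<And>i j. i < n \<Longrightarrow> j < n \<Longrightarrow> B (Suc i) (Suc j) = \<phi> (gap i j)" "\<phi> 0 = 0"
    "\<And>k. 1 \<le> k \<Longrightarrow> k < n div 2 \<Longrightarrow> \<phi> k \<le> \<phi> (Suc k)"
    "\<And>d. n div 2 < d \<Longrightarrow> d < n \<Longrightarrow> \<phi> (n - d) \<le> \<phi> d"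
    using up_benevolent_toeplitz_weight[OF assms(3)] by blast
  obtain c where c: "\<forall>t\<in>admissible_triples n. c t \<ge> 0"
    and A: "\<forall>i\<in>{1..n}. \<forall>j\<in>{1..n}.
      A i j = (\<Sum>(p, q, u)\<in>admissible_triples n. c (p, q, u) * C_matrix n p q u i j)"
    using assms(2) by (auto simp: PS_monotone_anti_Monge_def)
  define M where "M = (\<lambda>(p, q, u). C_matrix n p q u)"
  have AM: "\<forall>i\<in>{1..n}. \<forall>j\<in>{1..n}. A i j = (\<Sum>t\<in>admissible_triples n. c t * M t i j)"
    using A by (simp add: M_def case_prod_beta)
  have "qap_cost n A B id \<le> qap_cost n A B \<pi>" if \<pi>: "\<pi> permutes {1..n}" for \<pi>
    unfolding qap_cost_conic_combination[OF permutes_id AM] qap_cost_conic_combination[OF \<pi> AM]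
  proof (intro sum_mono mult_left_mono)
    fix t assume t: "t \<in> admissible_triples n"
    obtain p q u where pqu: "t = (p, q, u)" by (cases t)
    show "qap_cost n (M t) B id \<le> qap_cost n (M t) B \<pi>"
      using generator_identity_optimal[of n B \<phi> p q u \<pi>] \<phi> \<pi> t by (simp add: pqu M_def)
    show "0 \<le> c t" using c t by blast
  qed
  then show ?thesis
    unfolding qap_optimal_def is_arg_min_def using permutes_id by (metis not_less)
qed

end
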